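(* Let $\varepsilon>0$, $h>0$, and let $\sigma_s\ge 0$, $\sigma_a\ge 0$ be constants (independent of $x$) with $\sigma_t:=\sigma_s+\varepsilon^2\sigma_a>0$. Consider the following scheme, which for $k=0,1,2,\dots$ updates grid functions $\mathrm r^k$ (on the half grid points $(m+\tfrac12)h$) and $\mathrm j^k$ (on the full grid points $mh$), $m\in\mathbb Z$, by $$\begin{aligned} \mathrm r^{k+\frac12}&=\mathrm r^k-\Delta t\,(D_x\mathrm j^k+\sigma_a\mathrm r^k),\\ \mathrm j^{k+\frac12}&=\mathrm j^k-\Delta t\,(\phi D_x\mathrm r^k+\sigma_a\mathrm j^k),\\ \mathrm r^{k+1}&=\mathrm r^{k+\frac12},\\ \mathrm j^{k+1}&=\frac{\varepsilon^2}{\varepsilon^2+\sigma_s\Delta t}\,\mathrm j^{k+\frac12}-\frac{\Delta t}{\varepsilon^2+\sigma_s\Delta t}\,(1-\varepsilon^2\phi)\,D_x\mathrm r^{k+1}, \end{aligned}$$ where $D_x$ is the half-grid centered finite difference. Let the time step $\Delta t>0$ and the relaxation parameter $\phi$ satisfy $$\Delta t\le \min\left\{\tfrac{1}{\sigma_a},\ \max\left\{\tfrac12\,\varepsilon h,\ \tfrac14\,h^2\sigma_t\right\}\right\}$$ and $$0\le \phi\le \begin{cases}\dfrac{h\sigma_t}{2\varepsilon^3}, & h\sigma_t\le 2\varepsilon,\\[2mm] \dfrac1{\varepsilon^2}, & \text{otherwise.}\end{cases}$$ Then the numerical scheme is $L^2$-stable (in the sense of von Neumann analysis, see context).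
   Context: The scheme is the one-dimensional staggered-grid splitting scheme for the source-free two-velocity ($v\in\{\pm1\}$) transport equation in slab geometry with space-independent cross sections, written for the even parity $\mathrm r=\frac12[f(t,x,1)+f(t,x,-1)]$ and the odd parity $\mathrm j=\frac1{2\varepsilon}[f(t,x,1)-f(t,x,-1)]$, which satisfy $$\partial_t\mathrm r+\partial_x\mathrm j=-\sigma_a\mathrm r,\qquad \partial_t\mathrm j+\tfrac1{\varepsilon^2}\partial_x\mathrm r=-\tfrac{1}{\varepsilon^2}\sigma_s\mathrm j-\sigma_a\mathrm j .$$ Here $\varepsilon$ is the scaling parameter (mean free path), $h=\Delta x$ the mesh size, $\sigma_s$ the scattering, $\sigma_a$ the absorption and $\sigma_t=\sigma_s+\varepsilon^2\sigma_a$ the total coefficient. If $\sigma_a=0$, then $1/\sigma_a=+\infty$. The half-grid centered differences are $(D_x\mathrm r)_m=(\mathrm r_{m+1/2}-\mathrm r_{m-1/2})/h$ and $(D_x\mathrm j)_{m+1/2}=(\mathrm j_{m+1}-\mathrm j_m)/h$. Stability is understood and proved by von Neumann analysis. The parities are expanded in Fourier series with modes $\mathrm r=a_\ell(t)e^{i\ell x}$, $\mathrm j=b_\ell(t)e^{i\ell x}$, on which $D_x$ acts as multiplication by $d_\ell=\frac{2i}{h}\sin(\frac{\ell h}{2})$. One time step maps $(a_\ell,b_\ell)^T$ to $G(a_\ell,b_\ell)^T$ with growth factor matrix $G=G_2G_1$, $$G_1=\begin{bmatrix}1-\sigma_a\Delta t&-\Delta t\,d_\ell\\-\Delta t\,\phi\,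 d_\ell&1-\sigma_a\Delta t\end{bmatrix},\qquad G_2=\begin{bmatrix}1&0\\-\frac{\Delta t}{\varepsilon^2+\sigma_s\Delta t}(1-\varepsilon^2\phi)d_\ell&\frac{\varepsilon^2}{\varepsilon^2+\sigma_s\Delta t}\end{bmatrix}.$$ The stability criterion used is that, for every mode $\ell$, the eigenvalues $\lambda_1,\lambda_2$ of $G$ satisfy $|\lambda_{1,2}|\le1$ if $\lambda_1\ne\lambda_2$ and $|\lambda_{1,2}|<1$ if $\lambda_1=\lambda_2$. The result is presented as stability uniform in $\varepsilon$: the conditions apply for every $\varepsilon>0$, and as $\varepsilon\to0$ the time step restriction becomes $\Delta t\lesssim\min\{\frac1{\sigma_a},\frac14h^2\sigma_t\}$, which does not vanish. *)

theory Defs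
  imports "Jordan_Normal_Form.Char_Poly" "HOL-Library.Extended_Real" Complex_Main
begin

text \<open>
  Grid functions are complex-valued, so that Fourier modes can be inserted into the scheme.
  For r (half grid) the index m stands for the point (m + 1/2) h,
  for j (full grid) the index m stands for the point m h.
\<close>

type_synonym grid_fun = "int \<Rightarrow> complex"

definition Dx_half :: "real \<Rightarrow> grid_fun \<Rightarrow> grid_fun" where
  "Dx_half h r = (\<lambda>m. (r m - r (m - 1)) / of_real h)"

definition Dx_full :: "real \<Rightarrow> grid_fun \<Rightarrow> grid_fun" where
  "Dx_full h j = (\<lambda>m. (j (m + 1) - j m) / of_real h)"

text \<open>
  \<open>Dx_half\<close> differentiates a half grid function and lives on the full grid; \<open>Dx_full\<close> does
  the converse.
\<close>

definition scheme_step ::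
  "real \<Rightarrow> real \<Rightarrow> real \<Rightarrow> real \<Rightarrow> real \<Rightarrow> real \<Rightarrow> grid_fun \<times> grid_fun \<Rightarrow> grid_fun \<times> grid_fun" where
  "scheme_step \<epsilon> h \<sigma>s \<sigma>a \<Delta>t \<phi> = (\<lambda>(r, j).
     let r_mid = (\<lambda>m. r m - of_real \<Delta>t * (Dx_full h j m + of_real \<sigma>a * r m));
         j_mid = (\<lambda>m. j m - of_real \<Delta>t * (of_real \<phi> * Dx_half h r m + of_real \<sigma>a * j m));
         r_new = r_mid;
         j_new = (\<lambda>m. of_real (\<epsilon>\<^sup>2 / (\<epsilon>\<^sup>2 + \<sigma>s * \<Delta>t)) * j_mid m
                    - of_real (\<Delta>t / (\<epsilon>\<^sup>2 + \<sigma>s * \<Delta>t) * (1 - \<epsilon>\<^sup>2 * \<phi>)) * Dx_half h r_new m)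
     in (r_new, j_new))"

definition fourier_mode :: "real \<Rightarrow> real \<Rightarrow> complex vec \<Rightarrow> grid_fun \<times> grid_fun" where
  "fourier_mode h l v =
     (\<lambda>m. v $ 0 * cis (l * ((of_int m + 1/2) * h)),
      \<lambda>m. v $ 1 * cis (l * (of_int m * h)))"

text \<open>
  For \<open>h \<noteq> 0\<close> there is at most one growth factor matrix for each wave number \<open>l\<close>,
  because a mode determines its pair of coefficients.
\<close>

definition is_growth_matrix ::
  "real \<Rightarrow> (grid_fun \<times> grid_fun \<Rightarrow> grid_fun \<times> grid_fun) \<Rightarrow> real \<Rightarrow> complex mat \<Rightarrow> bool" where
  "is_growth_matrix h S l G \<longleftrightarrow> G \<in> carrier_mat 2 2 \<and>
     (\<forall>v \<in> carrier_vec 2. S (fourier_mode h l v) = fourier_mode h l (G *\<^sub>v v))"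

text \<open>
  The two eigenvalues are counted with algebraic multiplicity, so \<open>\<mu>1 = \<mu>2\<close> means a double root
  of the characteristic polynomial. Over the complex numbers it always splits, hence the
  quantification is never vacuous for a 2 by 2 matrix.
\<close>

definition eigenvalue_criterion :: "complex mat \<Rightarrow> bool" where
  "eigenvalue_criterion G \<longleftrightarrow>
     (\<forall>\<mu>1 \<mu>2. char_poly G = [:- \<mu>1, 1:] * [:- \<mu>2, 1:] \<longrightarrow>
        (\<mu>1 \<noteq> \<mu>2 \<longrightarrow> cmod \<mu>1 \<le> 1 \<and> cmod \<mu>2 \<le> 1) \<and>
        (\<mu>1 = \<mu>2 \<longrightarrow> cmod \<mu>1 < 1))"

definition von_neumann_stable ::
  "real \<Rightarrow> (grid_fun \<times> grid_fun \<Rightarrow> grid_fun \<times> grid_fun) \<Rightarrow> bool" where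
  "von_neumann_stable h S \<longleftrightarrow>
     (\<forall>l. \<exists>G. is_growth_matrix h S l G \<and> eigenvalue_criterion G)"

text \<open>
  The growth factor matrix of the scheme in closed form; \<open>d_symbol\<close> is the factor by which
  both differences multiply a mode.
\<close>

definition d_symbol :: "real \<Rightarrow> real \<Rightarrow> complex" where
  "d_symbol h l = 2 * \<i> / of_real h * of_real (sin (l * h / 2))"

definition G1 :: "real \<Rightarrow> real \<Rightarrow> real \<Rightarrow> real \<Rightarrow> real \<Rightarrow> complex mat" where
  "G1 h \<sigma>a \<Delta>t \<phi> l = mat_of_rows_list 2
     [[of_real (1 - \<sigma>a * \<Delta>t), - of_real \<Delta>t * d_symbol h l],
      [- of_real \<Delta>t * of_real \<phi> * d_symbol h l, of_real (1 - \<sigma>a * \<Delta>t)]]"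

definition G2 :: "real \<Rightarrow> real \<Rightarrow> real \<Rightarrow> real \<Rightarrow> real \<Rightarrow> real \<Rightarrow> complex mat" where
  "G2 \<epsilon> h \<sigma>s \<Delta>t \<phi> l = mat_of_rows_list 2
     [[1, 0],
      [- of_real (\<Delta>t / (\<epsilon>\<^sup>2 + \<sigma>s * \<Delta>t) * (1 - \<epsilon>\<^sup>2 * \<phi>)) * d_symbol h l,
       of_real (\<epsilon>\<^sup>2 / (\<epsilon>\<^sup>2 + \<sigma>s * \<Delta>t))]]"

lemma cis_half_diff: "cis (x + y) - cis (x - y) = 2 * \<i> * of_real (sin y) * cis x"
  by (simp add: complex_eq_iff cos_add cos_diff sin_add sin_diff)

lemma Dx_half_mode:
  "Dx_half h (\<lambda>m. c * cis (l * ((of_int m + 1/2) * h))) m =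
     d_symbol h l * (c * cis (l * (of_int m * h)))"
proof -
  have "l * ((of_int m + 1/2) * h) = l * (of_int m * h) + l * h / 2"
    "l * ((of_int (m - 1) + 1/2) * h) = l * (of_int m * h) - l * h / 2"
    by (simp_all add: algebra_simps)
  then have "c * cis (l * ((of_int m + 1/2) * h)) - c * cis (l * ((of_int (m - 1) + 1/2) * h))
    = c * (2 * \<i> * of_real (sin (l * h / 2)) * cis (l * (of_int m * h)))"
    unfolding cis_half_diff[symmetric] by (simp only: right_diff_distrib)
  then show ?thesis by (simp only: Dx_half_def d_symbol_def) simp
qed

lemma Dx_full_mode:
  "Dx_full h (\<lambda>m. c * cis (l * (of_int m * h))) m =
     d_symbol h l * (c * cis (l * ((of_int m + 1/2) * h)))"
proof -
  have "l * (of_int (m + 1) * h) = l * ((of_int m + 1/2) * h) + l * h / 2"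
    "l * (of_int m * h) = l * ((of_int m + 1/2) * h) - l * h / 2"
    by (simp_all add: algebra_simps)
  then have "c * cis (l * (of_int (m + 1) * h)) - c * cis (l * (of_int m * h))
    = c * (2 * \<i> * of_real (sin (l * h / 2)) * cis (l * ((of_int m + 1/2) * h)))"
    unfolding cis_half_diff[symmetric] by (simp only: right_diff_distrib)
  then show ?thesis by (simp only: Dx_full_def d_symbol_def) simp
qed

lemma growth_matrix_scheme_step:
  "is_growth_matrix h (scheme_step \<epsilon> h \<sigma>s \<sigma>a \<Delta>t \<phi>) l (G2 \<epsilon> h \<sigma>s \<Delta>t \<phi> l * G1 h \<sigma>a \<Delta>t \<phi> l)"
proof -
  let ?d = "d_symbol h l"
  let ?A = "G1 h \<sigma>a \<Delta>t \<phi> l" and ?B = "G2 \<epsilon> h \<sigma>s \<Delta>t \<phi> l"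
  define c where "c = \<epsilon>\<^sup>2 / (\<epsilon>\<^sup>2 + \<sigma>s * \<Delta>t)"
  define q where "q = \<Delta>t / (\<epsilon>\<^sup>2 + \<sigma>s * \<Delta>t) * (1 - \<epsilon>\<^sup>2 * \<phi>)"
  have A: "?A \<in> carrier_mat 2 2" and B: "?B \<in> carrier_mat 2 2"
    by (auto simp: G1_def G2_def mat_of_rows_list_def)
  have "scheme_step \<epsilon> h \<sigma>s \<sigma>a \<Delta>t \<phi> (fourier_mode h l v) = fourier_mode h l (?B * ?A *\<^sub>v v)"
    if v: "v \<in> carrier_vec 2" for v
  proof -
    define a where "a = v $ 0"
    define b where "b = v $ 1"
    define a' where "a' = of_real (1 - \<sigma>a * \<Delta>t) * a - of_real \<Delta>t * ?d * b"
    define b' where "b' = - of_real \<Delta>t * of_real \<phi> * ?d * a + of_real (1 - \<sigma>a * \<Delta>t) * b"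
    have Av: "?A *\<^sub>v v = vec_of_list [a', b']"
      using v by (intro eq_vecI)
        (auto simp: G1_def mat_of_rows_list_def scalar_prod_def a'_def b'_def a_def b_def
          less_Suc_eq numeral_2_eq_2)
    have "?B * ?A *\<^sub>v v = ?B *\<^sub>v (?A *\<^sub>v v)"
      using A B v by simp
    also have "\<dots> = vec_of_list [a', - of_real q * ?d * a' + of_real c * b']"
      unfolding Av by (intro eq_vecI)
        (auto simp: G2_def mat_of_rows_list_def scalar_prod_def less_Suc_eq numeral_2_eq_2
          c_def q_def)
    finally have BAv: "?B * ?A *\<^sub>v v = \<dots>" .
    define E where "E = (\<lambda>m. cis (l * ((of_int m + 1/2) * h)))"
    define F where "F = (\<lambda>m. cis (l * (of_int m * h)))"
    have DE: "Dx_half h (\<lambda>m. x * E m) m = ?d * (x * F m)"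
      and DF: "Dx_full h (\<lambda>m. x * F m) m = ?d * (x * E m)" for x m
      unfolding E_def F_def by (rule Dx_half_mode Dx_full_mode)+
    have mode: "fourier_mode h l w = (\<lambda>m. w $ 0 * E m, \<lambda>m. w $ 1 * F m)" for w
      by (simp add: fourier_mode_def E_def F_def)
    have r: "(\<lambda>m. a * E m - of_real \<Delta>t * (?d * (b * E m) + of_real \<sigma>a * (a * E m)))
        = (\<lambda>m. a' * E m)"
      by (simp add: a'_def algebra_simps)
    have j: "b * F m - of_real \<Delta>t * (of_real \<phi> * (?d * (a * F m)) + of_real \<sigma>a * (b * F m))
        = b' * F m" for m
      by (simp add: b'_def algebra_simps)
    have "scheme_step \<epsilon> h \<sigma>s \<sigma>a \<Delta>t \<phi> (fourier_mode h l v)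
      = (\<lambda>m. a' * E m, \<lambda>m. of_real c * (b' * F m) - of_real q * (?d * (a' * F m)))"
      unfolding mode scheme_step_def a_def[symmetric] b_def[symmetric] Let_def prod.case
        DE DF r j c_def[symmetric] q_def[symmetric] ..
    also have "\<dots> = fourier_mode h l (?B * ?A *\<^sub>v v)"
      unfolding BAv mode by (simp add: algebra_simps)
    finally show ?thesis .
  qed
  then show ?thesis
    unfolding is_growth_matrix_def using A B by auto
qed

text \<open>The convention for vanishing absorption holds for division of extended reals.\<close>

lemma one_divide_ereal_zero: "1 / ereal 0 = \<infinity>"
  by (simp add: divide_ereal_def flip: zero_ereal_def)

end

(*
  For every mode the growth matrix has a real characteristic polynomial z^2 - T z + D, so the
  Jury conditions |T| <= 1 + D and D <= 1 put both eigenvalues into the closed unit disc.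
  A mode multiplies differences by i s with s^2 <= 4 / h^2, and both branches of the time step
  restriction give s^2 \<Delta>t^2 <= \<epsilon>^2 or s^2 \<Delta>t^2 <= \<sigma>t \<Delta>t; the bound
  on \<phi> is made so that \<epsilon>^2 \<phi> s^2 \<Delta>t^2 <= \<sigma>t \<Delta>t in either branch.
  If \<phi> s^2 > 0, then |T| < 1 + D holds strictly, and otherwise D < 1; either way a double
  eigenvalue lies in the open disc.
*)

theory Submission
  imports Defs
begin

section \<open>Determinant and characteristic polynomial of 2 by 2 matrices\<close>

lemma det_mat_2:
  fixes A :: "'a::comm_ring_1 mat"
  assumes A: "A \<in> carrier_mat 2 2"
  shows "det A = A $$ (0,0) * A $$ (1,1) - A $$ (0,1) * A $$ (1,0)"
proof -
  have "mat_delete A i j \<in> carrier_mat 1 1" for i j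
    using A by (auto simp: mat_delete_def)
  then have "det (mat_delete A i j) = mat_delete A i j $$ (0,0)" for i j
    by (rule det_single)
  then have "cofactor A i j = (-1) ^ (i + j) * mat_delete A i j $$ (0,0)" for i j
    by (simp add: cofactor_def)
  then show ?thesis
    using A unfolding laplace_expansion_row[OF A, of 0, simplified]
    by (simp add: numeral_2_eq_2 mat_delete_def)
qed

lemma char_poly_mat_2:
  fixes G :: "'a::comm_ring_1 mat"
  assumes "G \<in> carrier_mat 2 2"
  shows "char_poly G =
    [:G $$ (0,0) * G $$ (1,1) - G $$ (0,1) * G $$ (1,0), - (G $$ (0,0) + G $$ (1,1)), 1:]"
  using assms unfolding char_poly_def char_poly_matrix_def
  by (subst det_mat_2) (auto simp: algebra_simps)

section \<open>Jury conditions for real quadratics\<close>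

text \<open>Nonreal roots are conjugate, so their common squared modulus is \<open>D\<close>. For
  real roots, \<open>T\<close> and \<open>D\<close> fix the signs of the polynomial at 1 and -1; a
  root beyond 1 or -1 would push the other root to that side as well, making the product exceed
  1.\<close>

lemma cmod_le_1_jury:
  fixes z w :: complex and T D :: real
  assumes sum: "z + w = of_real T" and prod: "z * w = of_real D"
    and T: "\<bar>T\<bar> \<le> 1 + D" and D: "D \<le> 1"
  shows "cmod z \<le> 1"
proof (cases "Im z = 0")
  case False
  have im: "Im w = - Im z"
    using arg_cong[OF sum, of Im] by simp
  then have "Im z * (Re w - Re z) = 0"
    using arg_cong[OF prod, of Im] by (simp add: algebra_simps)
  then have "w = cnj z"
    using False im by (simp add: complex_eq_iff)
  then have "(cmod z)\<^sup>2 = D"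
    using prod by (metis complex_norm_square of_real_eq_iff)
  then show ?thesis
    using D by (simp add: abs_square_le_1[symmetric, of "cmod z", simplified])
next
  case True
  define x y where "x = Re z" and "y = Re w"
  have "x + y = T" "x * y = D"
    using arg_cong[OF sum, of Re] arg_cong[OF prod, of Re] True by (simp_all add: x_def y_def)
  \<comment> \<open>The two products are \<open>1 - T + D\<close> and
    \<open>1 + T + D\<close>.\<close>
  then have *: "(1 - x) * (1 - y) \<ge> 0" "(1 + x) * (1 + y) \<ge> 0" "x * y \<le> 1"
    using T D by (simp_all add: algebra_simps abs_le_iff)
  have "x \<le> 1"
  proof (rule ccontr)
    assume "\<not> x \<le> 1"
    moreover from this have "y \<ge> 1"
      using *(1) by (simp add: zero_le_mult_iff)
    ultimately show False
      using *(3) mult_left_mono[of 1 y x] by linarith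
  qed
  moreover have "-1 \<le> x"
  proof (rule ccontr)
    assume "\<not> -1 \<le> x"
    moreover from this have "y \<le> -1"
      using *(2) by (simp add: zero_le_mult_iff)
    ultimately show False
      using *(3) mult_left_mono_neg[of y "-1" x] by linarith
  qed
  ultimately show ?thesis
    using True by (simp add: cmod_eq_Re x_def)
qed

text \<open>A double root is \<open>T / 2\<close> with \<open>D\<close> its square. Modulus 1 would
  force \<open>D = 1\<close> and \<open>\<bar>T\<bar> = 2 = 1 + D\<close>, against either
  alternative of \<open>strict\<close>.\<close>

lemma cmod_less_1_jury:
  fixes z :: complex and T D :: real
  assumes sum: "z + z = of_real T" and prod: "z * z = of_real D"
    and T: "\<bar>T\<bar> \<le> 1 + D" and D: "D \<le> 1" and strict: "D < 1 \<or> \<bar>T\<bar> < 1 + D"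
  shows "cmod z < 1"
proof -
  have "z = of_real (T / 2)"
    using sum by (simp flip: mult_2 add: field_simps)
  then have z: "cmod z = \<bar>T\<bar> / 2" and D2: "D = (T / 2)\<^sup>2"
    using prod by (simp_all add: power2_eq_square flip: of_real_mult of_real_divide)
  have "(cmod z)\<^sup>2 = D" "\<bar>T\<bar> = 2 * cmod z"
    unfolding z D2 by (simp_all add: power_divide)
  moreover have "cmod z \<le> 1"
    using cmod_le_1_jury[OF sum prod T D] .
  ultimately show ?thesis
    using strict by (cases "cmod z = 1") auto
qed

lemma eigenvalue_criterion_jury:
  fixes T D :: real
  assumes poly: "char_poly G = [:of_real D, - of_real T, 1:]"
    and "\<bar>T\<bar> \<le> 1 + D" "D \<le> 1" "D < 1 \<or> \<bar>T\<bar> < 1 + D"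
  shows "eigenvalue_criterion G"
  unfolding eigenvalue_criterion_def
proof (intro allI impI)
  fix z w assume "char_poly G = [:- z, 1:] * [:- w, 1:]"
  then have "z * w = of_real D" "- of_real T = - w - z"
    using poly by (simp_all add: mult.commute)
  \<comment> \<open>Both orders are stated because \<open>cmod_le_1_jury\<close> bounds only its
    first root.\<close>
  then have "z + w = of_real T" "w + z = of_real T" "z * w = of_real D" "w * z = of_real D"
    by (simp_all add: minus_equation_iff[of "of_real T"] algebra_simps)
  then show "(z \<noteq> w \<longrightarrow> cmod z \<le> 1 \<and> cmod w \<le> 1) \<and> (z = w \<longrightarrow> cmod z < 1)"
    using cmod_le_1_jury cmod_less_1_jury assms(2-4) by blast
qed

section \<open>Growth matrix of the scheme\<close>

text \<open>The symbol \<open>\<i> * s\<close> enters trace and determinant only through its square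
  \<open>- s\<^sup>2\<close>, so the coefficients are real although the matrix is not.\<close>

lemma char_poly_growth_matrix:
  fixes \<epsilon> h \<sigma>s \<sigma>a \<Delta>t \<phi> l :: real
  defines "s \<equiv> 2 / h * sin (l * h / 2)" and "\<alpha> \<equiv> 1 - \<sigma>a * \<Delta>t"
    and "c \<equiv> \<epsilon>\<^sup>2 / (\<epsilon>\<^sup>2 + \<sigma>s * \<Delta>t)"
    and "q \<equiv> \<Delta>t / (\<epsilon>\<^sup>2 + \<sigma>s * \<Delta>t) * (1 - \<epsilon>\<^sup>2 * \<phi>)"
  shows "char_poly (G2 \<epsilon> h \<sigma>s \<Delta>t \<phi> l * G1 h \<sigma>a \<Delta>t \<phi> l) =
    [:of_real (c * (\<alpha>\<^sup>2 + \<phi> * (\<Delta>t\<^sup>2 * s\<^sup>2))),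
      - of_real (\<alpha> * (1 + c) - q * \<Delta>t * s\<^sup>2), 1:]"
proof -
  have d: "d_symbol h l = \<i> * of_real s"
    by (simp add: d_symbol_def s_def)
  have dd: "\<i> * (\<i> * x) = - x" for x :: complex
    by (simp flip: mult.assoc)
  have G: "G2 \<epsilon> h \<sigma>s \<Delta>t \<phi> l * G1 h \<sigma>a \<Delta>t \<phi> l \<in> carrier_mat 2 2"
    by (auto simp: G1_def G2_def mat_of_rows_list_def)
  show ?thesis
    unfolding char_poly_mat_2[OF G]
    unfolding G1_def G2_def d \<alpha>_def[symmetric] c_def[symmetric] q_def[symmetric]
    by (simp add: mat_of_rows_list_def scalar_prod_def numeral_2_eq_2)
       (simp add: algebra_simps power2_eq_square dd)
qed

text \<open>Isolates what the restrictions on \<open>\<Delta>t\<close> and \<open>\<phi>\<close>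
  must deliver: \<open>\<epsilon>\<^sup>2 * \<phi> \<le> 1\<close> serves
  \<open>T \<le> 1 + D\<close>, the bound on \<open>p\<close> serves \<open>- T \<le> 1 + D\<close>,
  and the bound on \<open>\<phi> * p\<close> serves \<open>D \<le> 1\<close>.\<close>

lemma eigenvalue_criterion_growth_matrix:
  fixes \<epsilon> h \<sigma>s \<sigma>a \<Delta>t \<phi> l :: real
  defines "p \<equiv> \<Delta>t\<^sup>2 * (2 / h * sin (l * h / 2))\<^sup>2"
  assumes \<epsilon>: "\<epsilon> > 0" and \<sigma>s: "\<sigma>s \<ge> 0" and \<sigma>a: "\<sigma>a \<ge> 0" and \<Delta>t: "\<Delta>t > 0"
    and pos: "\<sigma>s + \<epsilon>\<^sup>2 * \<sigma>a > 0" and a: "\<sigma>a * \<Delta>t \<le> 1"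
    and \<phi>: "0 \<le> \<phi>" "\<epsilon>\<^sup>2 * \<phi> \<le> 1"
    and p: "p \<le> \<epsilon>\<^sup>2 + \<sigma>s * \<Delta>t"
    and \<phi>p: "\<epsilon>\<^sup>2 * (\<phi> * p) \<le> (\<sigma>s + \<epsilon>\<^sup>2 * \<sigma>a) * \<Delta>t"
  shows "eigenvalue_criterion (G2 \<epsilon> h \<sigma>s \<Delta>t \<phi> l * G1 h \<sigma>a \<Delta>t \<phi> l)"
proof -
  define N where "N = \<epsilon>\<^sup>2 + \<sigma>s * \<Delta>t"
  define \<alpha> where "\<alpha> = 1 - \<sigma>a * \<Delta>t"
  define c where "c = \<epsilon>\<^sup>2 / N"
  define D where "D = c * (\<alpha>\<^sup>2 + \<phi> * p)"
  define T where "T = \<alpha> * (1 + c) - (1 - \<epsilon>\<^sup>2 * \<phi>) * p / N"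
  have N: "N > 0" and c: "0 < c" "c \<le> 1"
    using \<epsilon> \<sigma>s \<Delta>t by (auto simp: N_def c_def add_pos_nonneg)
  have \<alpha>: "0 \<le> \<alpha>" "\<alpha> \<le> 1" and p0: "p \<ge> 0"
    using a \<sigma>a \<Delta>t by (simp_all add: \<alpha>_def p_def)
  \<comment> \<open>Positivity of the total coefficient means that absorption or scattering damps;
    this makes \<open>D = c * \<alpha>\<^sup>2\<close> strictly less than 1 when
    \<open>\<phi> * p = 0\<close>.\<close>
  have \<alpha>c: "\<alpha> < 1 \<or> c < 1"
  proof (cases "\<sigma>a = 0")
    case True
    then show ?thesis
      using pos \<Delta>t N by (simp add: c_def) (simp add: N_def)
  next
    case False
    then show ?thesis
      using \<sigma>a \<Delta>t by (simp add: \<alpha>_def)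
  qed
  have "char_poly (G2 \<epsilon> h \<sigma>s \<Delta>t \<phi> l * G1 h \<sigma>a \<Delta>t \<phi> l)
      = [:of_real D, - of_real T, 1:]"
    unfolding char_poly_growth_matrix D_def T_def c_def N_def \<alpha>_def p_def
    by (simp add: power2_eq_square mult_ac)
  moreover have "D \<le> 1"
  proof -
    \<comment> \<open>Replacing the square by \<open>\<alpha>\<close> itself lets the absorption
      term cancel exactly against the one in the bound on \<open>\<phi> * p\<close>, leaving
      \<open>N\<close>.\<close>
    have "\<epsilon>\<^sup>2 * \<alpha>\<^sup>2 \<le> \<epsilon>\<^sup>2 * \<alpha>"
      using \<alpha> by (intro mult_left_mono) (simp_all add: power2_eq_square mult_left_le)
    then have "\<epsilon>\<^sup>2 * (\<alpha>\<^sup>2 + \<phi> * p) \<le> N"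
      using \<phi>p by (simp add: N_def \<alpha>_def algebra_simps)
    then show ?thesis
      using N by (simp add: D_def c_def)
  qed
  moreover have upper: "T \<le> 1 + D" "\<phi> * p > 0 \<Longrightarrow> T < 1 + D"
  proof -
    have "1 + D - T = (1 - \<alpha>) * (1 - c * \<alpha>) + c * (\<phi> * p) + (1 - \<epsilon>\<^sup>2 * \<phi>) * p / N"
      by (simp add: D_def T_def algebra_simps power2_eq_square)
    moreover have "(1 - \<alpha>) * (1 - c * \<alpha>) \<ge> 0"
      using \<alpha> c by (simp add: mult_le_one)
    moreover have "(1 - \<epsilon>\<^sup>2 * \<phi>) * p / N \<ge> 0"
      using \<phi> p0 N by simp
    moreover have "c * (\<phi> * p) \<ge> 0"
      using c \<phi> p0 by simp
    moreover have "c * (\<phi> * p) > 0" if "\<phi> * p > 0"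
      using that c by (rule_tac mult_pos_pos)
    ultimately show "T \<le> 1 + D" "\<phi> * p > 0 \<Longrightarrow> T < 1 + D"
      by linarith+
  qed
  moreover have lower: "- T \<le> 1 + D" "\<phi> * p > 0 \<Longrightarrow> - T < 1 + D"
  proof -
    \<comment> \<open>Since \<open>\<epsilon>\<^sup>2 / N = c\<close>, \<open>T\<close> contributes
      a second copy of \<open>c * (\<phi> * p)\<close>. The leading product is at least 1 and
      absorbs \<open>p / N\<close>.\<close>
    have "1 + D + T = (1 + \<alpha>) * (1 + c * \<alpha>) - p / N + 2 * (c * (\<phi> * p))"
      using N by (simp add: D_def T_def c_def field_simps power2_eq_square)
    moreover have "(1 + \<alpha>) * (1 + c * \<alpha>) \<ge> 1"
      using \<alpha> c mult_mono[of 1 "1 + \<alpha>" 1 "1 + c * \<alpha>"] by simp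
    moreover have "p / N \<le> 1"
      using p N by (simp add: N_def)
    moreover have "c * (\<phi> * p) \<ge> 0"
      using c \<phi> p0 by simp
    moreover have "c * (\<phi> * p) > 0" if "\<phi> * p > 0"
      using that c by (rule_tac mult_pos_pos)
    ultimately show "- T \<le> 1 + D" "\<phi> * p > 0 \<Longrightarrow> - T < 1 + D"
      by linarith+
  qed
  moreover have "D < 1 \<or> \<bar>T\<bar> < 1 + D"
  proof (cases "\<phi> * p = 0")
    case True
    have "D = c * (\<alpha> * \<alpha>)"
      using True by (simp add: D_def power2_eq_square)
    moreover have "\<alpha> * \<alpha> \<le> \<alpha>" "c * (\<alpha> * \<alpha>) \<le> c" "c * (\<alpha> * \<alpha>) \<le> \<alpha> * \<alpha>"
      using \<alpha> c by (simp_all add: mult_left_le mult_left_le_one_le mult_le_one)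
    ultimately show ?thesis
      using \<alpha>c by linarith
  next
    case False
    then have "\<phi> * p > 0"
      using \<phi> p0 by (simp add: less_le)
    then show ?thesis
      using upper lower by linarith
  qed
  ultimately show ?thesis
    by (intro eigenvalue_criterion_jury[of _ D T]) auto
qed

section \<open>From the parameter restrictions to bounds on \<open>p\<close> and
  \<open>\<phi> * p\<close>\<close>

theorem proposition1:
  fixes \<epsilon> h \<sigma>s \<sigma>a \<sigma>t \<Delta>t \<phi> :: real
  assumes "\<epsilon> > 0" and "h > 0" and "\<sigma>s \<ge> 0" and "\<sigma>a \<ge> 0"
    and "\<sigma>t = \<sigma>s + \<epsilon>\<^sup>2 * \<sigma>a" and "\<sigma>t > 0"
    and "\<Delta>t > 0"
    and "ereal \<Delta>t \<le> min (1 / ereal \<sigma>a) (ereal (max (1/2 * \<epsilon> * h) (1/4 * h\<^sup>2 * \<sigma>t)))"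
    and "0 \<le> \<phi>"
    and "\<phi> \<le> (if h * \<sigma>t \<le> 2 * \<epsilon> then h * \<sigma>t / (2 * \<epsilon> ^ 3) else 1 / \<epsilon>\<^sup>2)"
  shows "von_neumann_stable h (scheme_step \<epsilon> h \<sigma>s \<sigma>a \<Delta>t \<phi>)"
  unfolding von_neumann_stable_def
proof (intro allI exI conjI)
  fix l
  show "is_growth_matrix h (scheme_step \<epsilon> h \<sigma>s \<sigma>a \<Delta>t \<phi>) l
      (G2 \<epsilon> h \<sigma>s \<Delta>t \<phi> l * G1 h \<sigma>a \<Delta>t \<phi> l)"
    by (rule growth_matrix_scheme_step)
  define p where "p = \<Delta>t\<^sup>2 * (2 / h * sin (l * h / 2))\<^sup>2"
  have p_le: "p \<le> 4 * \<Delta>t\<^sup>2 / h\<^sup>2"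
  proof -
    have "(sin (l * h / 2))\<^sup>2 \<le> 1"
      by (simp add: abs_square_le_1)
    then have "4 * \<Delta>t\<^sup>2 / h\<^sup>2 * (sin (l * h / 2))\<^sup>2 \<le> 4 * \<Delta>t\<^sup>2 / h\<^sup>2"
      by (intro mult_left_le) simp_all
    then show ?thesis
      by (simp add: p_def power_mult_distrib power_divide mult_ac)
  qed
  have "p \<ge> 0"
    by (simp add: p_def)
  have a: "\<sigma>a * \<Delta>t \<le> 1"
  \<comment> \<open>For zero absorption the extended real bound is infinite, but the claim is just 0
    \<le> 1.\<close>
  proof (cases "\<sigma>a = 0")
    case False
    then have "ereal \<Delta>t \<le> ereal (1 / \<sigma>a)"
      using assms(8) by (simp add: one_ereal_def)
    then show ?thesis
      using False assms(4) by (simp add: field_simps)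
  qed simp
  have step: "\<Delta>t \<le> max (1/2 * \<epsilon> * h) (1/4 * h\<^sup>2 * \<sigma>t)"
    using assms(8) unfolding min.bounded_iff ereal_less_eq(3) by simp
  have bounds: "\<epsilon>\<^sup>2 * \<phi> \<le> 1 \<and> p \<le> \<epsilon>\<^sup>2 + \<sigma>s * \<Delta>t \<and> \<epsilon>\<^sup>2 * (\<phi> * p) \<le> \<sigma>t * \<Delta>t"
  proof (cases "h * \<sigma>t \<le> 2 * \<epsilon>")
    case True
    \<comment> \<open>Multiplied by \<open>h\<close>, the case condition for \<open>\<phi>\<close>
      also decides the maximum in \<open>step\<close>: here it is
      \<open>1/2 * \<epsilon> * h\<close>.\<close>
    have "h * (h * \<sigma>t) \<le> h * (2 * \<epsilon>)"
      using True assms(2) by (intro mult_left_mono) simp_all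
    then have \<Delta>t: "2 * \<Delta>t \<le> \<epsilon> * h"
      using step by (simp add: power2_eq_square max_def algebra_simps split: if_splits)
    have "\<phi> \<le> h * \<sigma>t / (2 * \<epsilon> ^ 3)"
      using assms(10) True by simp
    then have \<phi>: "2 * \<epsilon> * (\<epsilon>\<^sup>2 * \<phi>) \<le> h * \<sigma>t"
      using assms(1) by (simp add: field_simps power2_eq_square power3_eq_cube)
    have "2 * \<epsilon> * (\<epsilon>\<^sup>2 * \<phi>) \<le> 2 * \<epsilon> * 1"
      using \<phi> True by linarith
    then have 1: "\<epsilon>\<^sup>2 * \<phi> \<le> 1"
      using assms(1) by (subst (asm) mult_le_cancel_left_pos) simp_all
    have "(2 * \<Delta>t)\<^sup>2 \<le> (\<epsilon> * h)\<^sup>2"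
      using \<Delta>t assms(7) by (intro power_mono) simp_all
    then have "4 * \<Delta>t\<^sup>2 / h\<^sup>2 \<le> \<epsilon>\<^sup>2"
      using assms(2) by (simp add: field_simps)
    then have 2: "p \<le> \<epsilon>\<^sup>2 + \<sigma>s * \<Delta>t"
      using p_le assms(3,7) by (smt (verit) mult_nonneg_nonneg)
    \<comment> \<open>Only one of the two factors \<open>2 * \<Delta>t\<close> is estimated by
      \<open>\<epsilon> * h\<close>, so the bound stays linear in \<open>\<Delta>t\<close>; the
      factor \<open>h\<close> is supplied by the bound on \<open>\<phi>\<close>.\<close>
    have "h * p \<le> 4 * \<Delta>t\<^sup>2 / h"
      using mult_left_mono[OF p_le, of h] assms(2) by (simp add: power2_eq_square)
    also have "\<dots> = 2 * \<Delta>t * (2 * \<Delta>t) / h"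
      by (simp add: power2_eq_square)
    also have "\<dots> \<le> 2 * \<Delta>t * (\<epsilon> * h) / h"
      using \<Delta>t assms(2,7) by (intro divide_right_mono mult_left_mono) simp_all
    finally have hp: "h * p \<le> 2 * \<epsilon> * \<Delta>t"
      using assms(2) by (simp add: mult_ac)
    have "2 * \<epsilon> * (\<epsilon>\<^sup>2 * (\<phi> * p)) \<le> \<sigma>t * (h * p)"
      using mult_right_mono[OF \<phi> \<open>p \<ge> 0\<close>] by (simp add: mult_ac)
    also have "\<dots> \<le> 2 * \<epsilon> * (\<sigma>t * \<Delta>t)"
      using mult_left_mono[OF hp, of \<sigma>t] assms(6) by (simp add: mult_ac)
    finally have "\<epsilon>\<^sup>2 * (\<phi> * p) \<le> \<sigma>t * \<Delta>t"
      using assms(1) by (subst (asm) mult_le_cancel_left_pos) simp_all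
    with 1 2 show ?thesis by blast
  next
    case False
    \<comment> \<open>Now the maximum is the parabolic bound
      \<open>1/4 * h\<^sup>2 * \<sigma>t\<close>.\<close>
    have "h * (2 * \<epsilon>) \<le> h * (h * \<sigma>t)"
      using False assms(2) by (intro mult_left_mono) simp_all
    then have \<Delta>t: "4 * \<Delta>t \<le> h\<^sup>2 * \<sigma>t"
      using step by (simp add: power2_eq_square max_def algebra_simps split: if_splits)
    have "\<phi> \<le> 1 / \<epsilon>\<^sup>2"
      using assms(10) False by simp
    then have 1: "\<epsilon>\<^sup>2 * \<phi> \<le> 1"
      using assms(1) by (simp add: field_simps)
    have "4 * \<Delta>t\<^sup>2 / h\<^sup>2 \<le> \<sigma>t * \<Delta>t"
      using mult_right_mono[OF \<Delta>t, of \<Delta>t] assms(2,7)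
      by (simp add: field_simps power2_eq_square)
    with p_le have p: "p \<le> \<sigma>t * \<Delta>t"
      by linarith
    \<comment> \<open>The absorption part of \<open>\<sigma>t * \<Delta>t\<close> is at most
      \<open>\<epsilon>\<^sup>2\<close> by \<open>a\<close>, so the single estimate \<open>p\<close>
      yields both remaining bounds.\<close>
    moreover have "\<sigma>t * \<Delta>t \<le> \<epsilon>\<^sup>2 + \<sigma>s * \<Delta>t"
      using mult_left_mono[OF a, of "\<epsilon>\<^sup>2"] by (simp add: assms(5) algebra_simps)
    moreover have "\<epsilon>\<^sup>2 * \<phi> * p \<le> p"
      using 1 \<open>p \<ge> 0\<close> assms(9) by (intro mult_left_le_one_le) simp_all
    ultimately show ?thesis
      using 1 by (simp add: mult.assoc)
  qed
  then show "eigenvalue_criterion (G2 \<epsilon> h \<sigma>s \<Delta>t \<phi> l * G1 h \<sigma>a \<Delta>t \<phi> l)"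
    using assms(1-7,9) a by (intro eigenvalue_criterion_growth_matrix) (simp_all add: p_def)
qed

end
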